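(* Let $\mu\in\mathcal{P}(\mathbb{R}^p)$, $\nu\in\mathcal{P}(\mathbb{R}^q)$ with $\int\|\mathbf{x}\|_2^4d\mu(\mathbf{x})<+\infty$ and $\int\|\mathbf{y}\|_2^4d\nu(\mathbf{y})<+\infty$. Suppose without loss of generality that $p\ge q$ and let $F_{p,q}=\{\mathbf{P}\in\mathbb{R}^{q\times p}:\|\mathbf{P}\|_F=\sqrt p\}$. Then the problems $$\inf_{\pi\in\Pi(\mu,\nu)}\iint\big(\langle\mathbf{x},\mathbf{x}'\rangle_p-\langle\mathbf{y},\mathbf{y}'\rangle_q\big)^2d\pi(\mathbf{x},\mathbf{y})\,d\pi(\mathbf{x}',\mathbf{y}')$$ and $$\sup_{\pi\in\Pi(\mu,\nu)}\ \sup_{\mathbf{P}\in F_{p,q}}\int\langle\mathbf{P}\mathbf{x},\mathbf{y}\rangle_q\,d\pi(\mathbf{x},\mathbf{y})$$ are equivalent: $\pi^*\in\Pi(\mu,\nu)$ is an optimal solution of the first problem if and only if $\pi^*$ is an optimal solution of the second.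
   Context: $\mathcal{P}(\cdot)$ denotes Borel probability measures, $\Pi(\mu,\nu)$ the set of couplings of $\mu$ and $\nu$, $\langle\cdot,\cdot\rangle_p$ the Euclidean inner product of $\mathbb{R}^p$, and $\|\cdot\|_F$ the Frobenius norm. A coupling $\pi^*$ is optimal for the second problem if it maximizes $\pi\mapsto\sup_{\mathbf{P}\in F_{p,q}}\int\langle\mathbf{P}\mathbf{x},\mathbf{y}\rangle_q d\pi$ over $\Pi(\mu,\nu)$. *)

theory Defs
  imports "HOL-Probability.Probability"
begin

definition borel_prob :: "'a::topological_space measure \<Rightarrow> bool" where
  "borel_prob M \<longleftrightarrow> prob_space M \<and> sets M = sets borel"

definition couplings ::
  "'a::topological_space measure \<Rightarrow> 'b::topological_space measure \<Rightarrow> ('a \<times> 'b) measure set" where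
  "couplings \<mu> \<nu> = {\<pi>. borel_prob \<pi> \<and> distr \<pi> borel fst = \<mu> \<and> distr \<pi> borel snd = \<nu>}"

definition frobenius_norm :: "real ^ 'p ^ 'q \<Rightarrow> real" where
  "frobenius_norm P = sqrt (\<Sum>i\<in>UNIV. \<Sum>j\<in>UNIV. (P $ i $ j)\<^sup>2)"

text \<open>Matrices of type \<^typ>\<open>real ^ 'p ^ 'q\<close> have \<open>q\<close> rows and \<open>p\<close> columns.\<close>

definition frobenius_sphere :: "(real ^ 'p ^ 'q) set" where
  "frobenius_sphere = {P. frobenius_norm P = sqrt (real CARD('p))}"

text \<open>The integrand is nonnegative, so the extended nonnegative integral is used; its value is
  meaningful without any integrability side condition.\<close>

definition gw_objective :: "((real ^ 'p) \<times> (real ^ 'q)) measure \<Rightarrow> ennreal" where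
  "gw_objective \<pi> =
     (\<integral>\<^sup>+ (x, y). (\<integral>\<^sup>+ (x', y'). ennreal ((x \<bullet> x' - y \<bullet> y')\<^sup>2) \<partial>\<pi>) \<partial>\<pi>)"

text \<open>The supremum is taken in the extended reals, where it always exists.\<close>

definition align_objective :: "((real ^ 'p) \<times> (real ^ 'q)) measure \<Rightarrow> ereal" where
  "align_objective \<pi> =
     (SUP P \<in> (frobenius_sphere :: (real ^ 'p ^ 'q) set).
        ereal (\<integral> (x, y). (P *v x) \<bullet> y \<partial>\<pi>))"

end

theory Submission
  imports Defs
begin

text \<open>Let \<open>M\<close> be the \<open>\<pi>\<close>-average of the matrices \<open>y x\<^sup>T\<close>. Since
  \<open>\<langle>P x, y\<rangle> = \<langle>P, y x\<^sup>T\<rangle>\<close> for the Frobenius inner product, the second objective is the maximum of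
  \<open>\<langle>P, M\<rangle>\<close> over a sphere, that is \<open>sqrt p * norm M\<close>. Expanding the square in the first objective
  and using \<open>\<langle>y, y'\<rangle> \<langle>x, x'\<rangle> = \<langle>y x\<^sup>T, y' x'\<^sup>T\<rangle>\<close> gives \<open>C - 2 (norm M)\<^sup>2\<close>, where \<open>C\<close> depends on
  the marginals only. Both problems therefore amount to maximizing \<open>norm M\<close>.\<close>

definition outer :: "real ^ 'm \<Rightarrow> real ^ 'n \<Rightarrow> real ^ 'n ^ 'm" where
  "outer a b = (\<chi> i j. a $ i * b $ j)"

lemma inner_outer_outer: "outer a b \<bullet> outer c d = (a \<bullet> c) * (b \<bullet> d)"
  unfolding inner_vec_def sum_product by (simp add: outer_def algebra_simps)

lemma norm_outer: "norm (outer a b) = norm a * norm b"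
  by (simp add: norm_eq_sqrt_inner inner_outer_outer real_sqrt_mult)

lemma inner_outer_right: "P \<bullet> outer y x = (P *v x) \<bullet> y"
  by (simp add: outer_def inner_vec_def matrix_vector_mult_def sum_distrib_left sum_distrib_right
      algebra_simps)

lemma continuous_on_outer [continuous_intros]:
  assumes "continuous_on S f" "continuous_on S g"
  shows "continuous_on S (\<lambda>w. outer (f w) (g w))"
  unfolding outer_def using assms by (intro continuous_intros)

lemma frobenius_norm_eq_norm: "frobenius_norm P = norm P"
  by (simp add: frobenius_norm_def norm_eq_sqrt_inner inner_vec_def power2_eq_square)

text \<open>Cauchy-Schwarz bounds every term by \<open>r * norm m\<close>, and the point of the
  sphere in the direction of \<open>m\<close> attains this bound.\<close>

lemma SUP_inner_sphere:
  fixes m :: "'a::euclidean_space"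
  assumes "0 \<le> r"
  shows "(SUP P \<in> {P. norm P = r}. ereal (P \<bullet> m)) = ereal (r * norm m)"
proof (rule antisym)
  show "(SUP P \<in> {P. norm P = r}. ereal (P \<bullet> m)) \<le> ereal (r * norm m)"
    by (rule SUP_least) (use norm_cauchy_schwarz[of _ m] in auto)
next
  \<comment> \<open>For \<open>m = 0\<close> there is no direction to normalise, but the sphere
    still has to supply a point; any basis vector serves.\<close>
  obtain u :: 'a where u: "norm u = 1" "u \<bullet> m = norm m"
  proof (cases "m = 0")
    case True
    then show thesis using that[of "SOME i. i \<in> Basis"] by (simp add: SOME_Basis)
  next
    case False
    then show thesis using that[of "sgn m"]
      by (simp add: norm_sgn sgn_div_norm power2_norm_eq_inner[symmetric] power2_eq_square)
  qed
  show "ereal (r * norm m) \<le> (SUP P \<in> {P. norm P = r}. ereal (P \<bullet> m))"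
    by (rule SUP_upper2[of "r *\<^sub>R u"]) (use u assms in auto)
qed

lemma integrable_norm_square_of_fourth_moment:
  fixes M :: "'a::euclidean_space measure"
  assumes "borel_prob M" "(\<integral>\<^sup>+ x. ennreal (norm x ^ 4) \<partial>M) < \<infinity>"
  shows "integrable M (\<lambda>x. (norm x)\<^sup>2)"
proof -
  interpret prob_space M using assms(1) by (simp add: borel_prob_def)
  have [measurable_cong]: "sets M = sets borel" using assms(1) by (simp add: borel_prob_def)
  have "integrable M (\<lambda>x. 1 + norm x ^ 4)"
    using assms(2) by (intro Bochner_Integration.integrable_add integrableI_nonneg)
      (auto simp: emeasure_space_1)
  moreover have "(norm x)\<^sup>2 \<le> 1 + norm x ^ 4" for x :: 'a
  proof -
    \<comment> \<open>With t = \<open>norm x\<close>, the right-hand side expands to t^4 - t^2 +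
      1.\<close>
    have "0 \<le> ((norm x)\<^sup>2 - 1)\<^sup>2 + (norm x)\<^sup>2" by simp
    then show ?thesis by (simp add: power2_eq_square power4_eq_xxxx algebra_simps)
  qed
  ultimately show ?thesis
    by (auto intro: Bochner_Integration.integrable_bound)
qed

text \<open>The norm of an outer product is the product of the norms, which the sum of their squares
  dominates. Second moments therefore suffice.\<close>

lemma integrable_outer:
  fixes f :: "'a::euclidean_space \<Rightarrow> real ^ 'm" and g :: "'a \<Rightarrow> real ^ 'n"
  assumes "sets M = sets borel" "continuous_on UNIV f" "continuous_on UNIV g"
    and "integrable M (\<lambda>w. (norm (f w))\<^sup>2)" "integrable M (\<lambda>w. (norm (g w))\<^sup>2)"
  shows "integrable M (\<lambda>w. outer (f w) (g w))"
proof (rule Bochner_Integration.integrable_bound)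
  show "integrable M (\<lambda>w. (norm (f w))\<^sup>2 + (norm (g w))\<^sup>2)"
    using assms(4,5) by simp
  show "(\<lambda>w. outer (f w) (g w)) \<in> borel_measurable M"
    unfolding measurable_cong_sets[OF assms(1) refl]
    using assms(2,3) by (intro borel_measurable_continuous_onI continuous_intros)
  have "norm a * norm b \<le> (norm a)\<^sup>2 + (norm b)\<^sup>2" for a :: "real ^ 'm" and b :: "real ^ 'n"
    using sum_squares_bound[of "norm a" "norm b"] mult_nonneg_nonneg[OF norm_ge_zero[of a] norm_ge_zero[of b]]
    by linarith
  then show "AE w in M. norm (outer (f w) (g w)) \<le> norm ((norm (f w))\<^sup>2 + (norm (g w))\<^sup>2)"
    by (simp add: norm_outer)
qed

text \<open>The matrix M of the overview: the uncentred cross-covariance, with \<open>snd\<close>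
  giving the rows so that it has the type of \<open>P\<close>.\<close>

definition cross_moment :: "((real ^ 'p) \<times> (real ^ 'q)) measure \<Rightarrow> real ^ 'p ^ 'q" where
  "cross_moment \<pi> = (\<integral>w. outer (snd w) (fst w) \<partial>\<pi>)"

definition second_moment :: "(real ^ 'n) measure \<Rightarrow> real ^ 'n ^ 'n" where
  "second_moment \<mu> = (\<integral>x. outer x x \<partial>\<mu>)"

context
  fixes \<mu> :: "(real ^ 'p) measure" and \<nu> :: "(real ^ 'q) measure"
    and \<pi> :: "((real ^ 'p) \<times> (real ^ 'q)) measure"
  assumes \<mu>2: "integrable \<mu> (\<lambda>x. (norm x)\<^sup>2)" and \<nu>2: "integrable \<nu> (\<lambda>y. (norm y)\<^sup>2)"
    and coupling: "\<pi> \<in> couplings \<mu> \<nu>"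
begin

lemma sets_coupling: "sets \<pi> = sets borel"
  and distr_fst: "distr \<pi> borel fst = \<mu>"
  and distr_snd: "distr \<pi> borel snd = \<nu>"
  using coupling by (auto simp: couplings_def borel_prob_def)

lemma measurable_fst_coupling: "fst \<in> \<pi> \<rightarrow>\<^sub>M borel"
  and measurable_snd_coupling: "snd \<in> \<pi> \<rightarrow>\<^sub>M borel"
  unfolding measurable_cong_sets[OF sets_coupling refl]
  by (intro borel_measurable_continuous_onI continuous_intros)+

lemma integrable_coupling_norm_square:
  "integrable \<pi> (\<lambda>w. (norm (fst w))\<^sup>2)" "integrable \<pi> (\<lambda>w. (norm (snd w))\<^sup>2)"
  using \<mu>2 \<nu>2 integrable_distr[OF measurable_fst_coupling] integrable_distr[OF measurable_snd_coupling]
  by (auto simp: distr_fst distr_snd)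

lemma integrable_coupling_outer:
  "integrable \<pi> (\<lambda>w. outer (fst w) (fst w))"
  "integrable \<pi> (\<lambda>w. outer (snd w) (fst w))"
  "integrable \<pi> (\<lambda>w. outer (snd w) (snd w))"
  by (intro integrable_outer sets_coupling integrable_coupling_norm_square continuous_intros)+

text \<open>Change of variables along the two projections. This is what makes the constant C the
  same for all couplings.\<close>

lemma second_moment_coupling:
  "(\<integral>w. outer (fst w) (fst w) \<partial>\<pi>) = second_moment \<mu>"
  "(\<integral>w. outer (snd w) (snd w) \<partial>\<pi>) = second_moment \<nu>"
proof -
  have "(\<lambda>x :: real ^ 'p. outer x x) \<in> borel_measurable borel"
    by (intro borel_measurable_continuous_onI continuous_intros)
  note * = integral_distr[OF measurable_fst_coupling, OF this]
  have "(\<lambda>x :: real ^ 'q. outer x x) \<in> borel_measurable borel"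
    by (intro borel_measurable_continuous_onI continuous_intros)
  note ** = integral_distr[OF measurable_snd_coupling, OF this]
  show "(\<integral>w. outer (fst w) (fst w) \<partial>\<pi>) = second_moment \<mu>"
    "(\<integral>w. outer (snd w) (snd w) \<partial>\<pi>) = second_moment \<nu>"
    using * ** by (simp_all add: distr_fst distr_snd second_moment_def)
qed

lemma align_objective_eq:
  "align_objective \<pi> = ereal (sqrt (real CARD('p)) * norm (cross_moment \<pi>))"
proof -
  \<comment> \<open>The integrand is the linear functional \<open>P \<bullet> _\<close> applied to
    the outer product, so it commutes with the Bochner integral.\<close>
  have "(\<integral>(x, y). (P *v x) \<bullet> y \<partial>\<pi>) = P \<bullet> cross_moment \<pi>" for P
    unfolding cross_moment_def integral_inner_right[OF integrable_coupling_outer(2), symmetric]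
    by (simp add: inner_outer_right case_prod_unfold)
  then show ?thesis
    by (simp add: align_objective_def frobenius_sphere_def frobenius_norm_eq_norm SUP_inner_sphere)
qed

text \<open>The expanded kernel is a combination of inner products of a matrix in \<open>w\<close>
  with the same matrix in \<open>w'\<close>. Each integration replaces one factor by its mean,
  leaving squared norms of the moments. The bound \<open>0 \<le> c\<close> is recorded because
  \<open>ennreal\<close> sends all negative reals to 0.\<close>

lemma gw_objective_eq:
  defines "c \<equiv> (norm (second_moment \<mu>))\<^sup>2 + (norm (second_moment \<nu>))\<^sup>2
    - 2 * (norm (cross_moment \<pi>))\<^sup>2"
  shows "gw_objective \<pi> = ennreal c" and "0 \<le> c"
proof -
  let ?A = "\<lambda>w. outer (fst w) (fst w) :: real ^ 'p ^ 'p"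
  let ?B = "\<lambda>w. outer (snd w) (fst w) :: real ^ 'p ^ 'q"
  let ?C = "\<lambda>w. outer (snd w) (snd w) :: real ^ 'q ^ 'q"
  let ?k = "\<lambda>w w'. (fst w \<bullet> fst w' - snd w \<bullet> snd w')\<^sup>2"
  let ?h = "\<lambda>w. ?A w \<bullet> second_moment \<mu> - 2 * (?B w \<bullet> cross_moment \<pi>) + ?C w \<bullet> second_moment \<nu>"
  note int = integrable_coupling_outer
  have k: "?k w w' = ?A w \<bullet> ?A w' - 2 * (?B w \<bullet> ?B w') + ?C w \<bullet> ?C w'" for w w'
    by (simp add: inner_outer_outer power2_eq_square algebra_simps)
  have inner_int: "integrable \<pi> (?k w)" for w
    unfolding k using int
    by (intro Bochner_Integration.integrable_add Bochner_Integration.integrable_diff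
        integrable_mult_right integrable_inner_right) auto
  have h: "(\<integral>w'. ?k w w' \<partial>\<pi>) = ?h w" for w
    unfolding k using int by (simp add: second_moment_coupling cross_moment_def)
  \<comment> \<open>The sign is not visible in the formula for \<open>?h\<close>; it comes from the
    integral of a square that \<open>?h\<close> evaluates.\<close>
  have h_nonneg: "0 \<le> ?h w" for w
    unfolding h[symmetric] by simp
  have "integrable \<pi> ?h"
    using int by (intro Bochner_Integration.integrable_add Bochner_Integration.integrable_diff
        integrable_mult_right integrable_inner_left) auto
  moreover have h_int: "(\<integral>w. ?h w \<partial>\<pi>) = c"
    using int by (simp add: second_moment_coupling cross_moment_def[symmetric] c_def
        power2_norm_eq_inner)
  ultimately have "(\<integral>\<^sup>+ w. ennreal (?h w) \<partial>\<pi>) = ennreal c"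
    using h_nonneg by (subst nn_integral_eq_integral) auto
  moreover have "(\<integral>\<^sup>+ w'. ennreal (?k w w') \<partial>\<pi>) = ennreal (?h w)" for w
    using inner_int by (subst nn_integral_eq_integral) (auto simp: h)
  ultimately show "gw_objective \<pi> = ennreal c"
    by (simp add: gw_objective_def case_prod_unfold)
  show "0 \<le> c"
    unfolding h_int[symmetric] using h_nonneg by (intro Bochner_Integration.integral_nonneg) auto
qed

end

theorem theorem4p2p1:
  fixes \<mu> :: "(real ^ 'p) measure" and \<nu> :: "(real ^ 'q) measure"
    and \<pi>\<^sub>0 :: "((real ^ 'p) \<times> (real ^ 'q)) measure"
  assumes "borel_prob \<mu>" and "borel_prob \<nu>"
    and "(\<integral>\<^sup>+ x. ennreal (norm x ^ 4) \<partial>\<mu>) < \<infinity>"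
    and "(\<integral>\<^sup>+ y. ennreal (norm y ^ 4) \<partial>\<nu>) < \<infinity>"
    and "CARD('q) \<le> CARD('p)"
    and "\<pi>\<^sub>0 \<in> couplings \<mu> \<nu>"
  shows "is_arg_min gw_objective (\<lambda>\<pi>. \<pi> \<in> couplings \<mu> \<nu>) \<pi>\<^sub>0 \<longleftrightarrow>
         is_arg_max align_objective (\<lambda>\<pi>. \<pi> \<in> couplings \<mu> \<nu>) \<pi>\<^sub>0"
proof -
  have moments: "integrable \<mu> (\<lambda>x. (norm x)\<^sup>2)" "integrable \<nu> (\<lambda>y. (norm y)\<^sup>2)"
    using assms(1-4) by (auto intro: integrable_norm_square_of_fourth_moment)
  \<comment> \<open>Optimality of \<open>\<pi>\<^sub>0\<close> means that no coupling is strictly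
    better, so it is enough that the two objectives order each coupling against
    \<open>\<pi>\<^sub>0\<close> in opposite ways.\<close>
  have "gw_objective \<pi> < gw_objective \<pi>\<^sub>0 \<longleftrightarrow> align_objective \<pi>\<^sub>0 < align_objective \<pi>"
    if \<pi>: "\<pi> \<in> couplings \<mu> \<nu>" for \<pi>
  proof -
    \<comment> \<open>Both values share the marginal terms, which cancel; nonnegativity lets the
      comparison descend from \<open>ennreal\<close> to the reals.\<close>
    have "gw_objective \<pi> < gw_objective \<pi>\<^sub>0 \<longleftrightarrow> (norm (cross_moment \<pi>\<^sub>0))\<^sup>2 < (norm (cross_moment \<pi>))\<^sup>2"
      using gw_objective_eq[OF moments \<pi>] gw_objective_eq[OF moments assms(6)]
      by (simp add: ennreal_less_iff)
    also have "\<dots> \<longleftrightarrow> align_objective \<pi>\<^sub>0 < align_objective \<pi>"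
      \<comment> \<open>Squaring preserves the order of nonnegative numbers, and the factor
        \<open>sqrt (real CARD('p))\<close> is positive.\<close>
      using power_mono_iff[of "norm (cross_moment \<pi>)" "norm (cross_moment \<pi>\<^sub>0)" 2]
      by (simp add: align_objective_eq[OF moments \<pi>] align_objective_eq[OF moments assms(6)]
          not_le[symmetric])
    finally show ?thesis .
  qed
  then show ?thesis
    by (auto simp: is_arg_min_def is_arg_max_def)
qed

end
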